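(* Let $n\ge1$, $s\in\{0,1,\ldots,n-1\}$, and $f\in C^2(\mathbb{R}^n,\mathbb{R})$. Let $\bar x$ be a BF-vector for SCNO with $\|\bar x\|_0=k$. If $\bar x$ is nondegenerate as an M-stationary point for SCNO, then $k=s$. The same applies for CW-minima: if $\bar x$ is a CW-minimum for SCNO with $\|\bar x\|_0=k$ that is nondegenerate as an M-stationary point, then $k=s$.
   Context: For $x\in\mathbb{R}^n$, $\|x\|_0$ is the number of non-zero entries of $x$, and $\mathbb{R}^{n,s}=\{x\in\mathbb{R}^n : \|x\|_0\le s\}$. SCNO is the problem $\min f(x)$ s.t. $x\in\mathbb{R}^{n,s}$. For $x\in\mathbb{R}^{n,s}$ put $I_0(x)=\{i: x_i=0\}$ and $I_1(x)=\{i: x_i\neq 0\}$, and let $e_i$ be the coordinate vectors of $\mathbb{R}^n$. A point $\bar x\in\mathbb{R}^{n,s}$ is M-stationary if $\frac{\partial f}{\partial x_i}(\bar x)=0$ for all $i\in I_1(\bar x)$. An M-stationary point $\bar x$ with $\|\bar x\|_0=k$ is nondegenerate if: (ND1) if $k<s$ then $\frac{\partial f}{\partial x_i}(\bar x)\ne0$ for all $i\in I_0(\bar x)$; and (ND2) the matrix $\left(\frac{\partial^2 f}{\partial x_i\partial x_j}(\bar x)\right)_{i,j\in I_1(\bar x)}$ is nonsingular. A vector $\bar x\in\mathbb{R}^{n,s}$ with $\|\bar x\|_0=k$ is a BF-vector (basic feasible) if: (BF1) in case $k<s$, $\frac{\partial f}{\partial x_i}(\bar x)=0$ for all $i=1,\ldots,n$;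 (BF2) in case $k=s$, $\frac{\partial f}{\partial x_i}(\bar x)=0$ for all $i\in I_1(\bar x)$. A vector $\bar x\in\mathbb{R}^{n,s}$ with $\|\bar x\|_0=k$ is a CW-minimum (coordinate-wise minimum) if: (CW1) in case $k<s$, $f(\bar x)=\min_{t\in\mathbb{R}}f(\bar x+te_i)$ for all $i=1,\ldots,n$; (CW2) in case $k=s$, $f(\bar x)\le\min_{t\in\mathbb{R}}f(\bar x-\bar x_ie_i+te_j)$ for all $i\in I_1(\bar x)$ and $j=1,\ldots,n$ (i.e. $f(\bar x)\le f(\bar x-\bar x_ie_i+te_j)$ for all $t\in\mathbb{R}$). Both BF-vectors and CW-minima are M-stationary. *)

theory Defs
  imports "HOL-Analysis.Analysis"
begin

definition l0 :: "real ^ 'n \<Rightarrow> nat" where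
  "l0 x = card {i. x $ i \<noteq> 0}"

definition sparse_set :: "nat \<Rightarrow> (real ^ 'n) set" where
  "sparse_set s = {x. l0 x \<le> s}"

definition I0 :: "real ^ 'n \<Rightarrow> 'n set" where
  "I0 x = {i. x $ i = 0}"

definition I1 :: "real ^ 'n \<Rightarrow> 'n set" where
  "I1 x = {i. x $ i \<noteq> 0}"

abbreviation coord_vec :: "'n \<Rightarrow> real ^ 'n" where
  "coord_vec i \<equiv> axis i 1"

definition partial :: "'n \<Rightarrow> (real ^ 'n \<Rightarrow> real) \<Rightarrow> real ^ 'n \<Rightarrow> real" where
  "partial i f x = deriv (\<lambda>t. f (x + t *\<^sub>R coord_vec i)) 0"

(* deriv is unspecified where the derivative does not exist, so existence of the
   partial derivatives is demanded separately from their continuity. *)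
definition C1 :: "(real ^ 'n \<Rightarrow> real) \<Rightarrow> bool" where
  "C1 f \<longleftrightarrow>
     (\<forall>i x. (\<lambda>t. f (x + t *\<^sub>R coord_vec i)) field_differentiable (at 0)) \<and>
     (\<forall>i. continuous_on UNIV (partial i f))"

definition C2 :: "(real ^ 'n \<Rightarrow> real) \<Rightarrow> bool" where
  "C2 f \<longleftrightarrow> C1 f \<and> (\<forall>i. C1 (partial i f))"

(* Determinant of the square matrix with rows and columns indexed by the set I,
   by the Leibniz formula; it equals 1 for empty I. *)
definition det_on :: "'n set \<Rightarrow> ('n \<Rightarrow> 'n \<Rightarrow> real) \<Rightarrow> real" where
  "det_on I A = (\<Sum>p | p permutes I. of_int (sign p) * (\<Prod>i\<in>I. A i (p i)))"

lemma det_on_UNIV: "det_on UNIV (\<lambda>i j. A $ i $ j) = det (A :: real ^ 'n ^ 'n)"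
  by (simp add: det_on_def det_def)

definition M_stationary :: "(real ^ 'n \<Rightarrow> real) \<Rightarrow> nat \<Rightarrow> real ^ 'n \<Rightarrow> bool" where
  "M_stationary f s x \<longleftrightarrow> x \<in> sparse_set s \<and> (\<forall>i\<in>I1 x. partial i f x = 0)"

definition nondegenerate_M_stationary ::
    "(real ^ 'n \<Rightarrow> real) \<Rightarrow> nat \<Rightarrow> real ^ 'n \<Rightarrow> bool" where
  "nondegenerate_M_stationary f s x \<longleftrightarrow>
     M_stationary f s x \<and>
     (l0 x < s \<longrightarrow> (\<forall>i\<in>I0 x. partial i f x \<noteq> 0)) \<and>
     det_on (I1 x) (\<lambda>i j. partial i (partial j f) x) \<noteq> 0"

definition BF_vector :: "(real ^ 'n \<Rightarrow> real) \<Rightarrow> nat \<Rightarrow> real ^ 'n \<Rightarrow> bool" where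
  "BF_vector f s x \<longleftrightarrow>
     x \<in> sparse_set s \<and>
     (l0 x < s \<longrightarrow> (\<forall>i. partial i f x = 0)) \<and>
     (l0 x = s \<longrightarrow> (\<forall>i\<in>I1 x. partial i f x = 0))"

(* In the case l0 x < s the value f x is attained at t = 0, so being the minimum
   over t amounts to being a lower bound. *)
definition CW_minimum :: "(real ^ 'n \<Rightarrow> real) \<Rightarrow> nat \<Rightarrow> real ^ 'n \<Rightarrow> bool" where
  "CW_minimum f s x \<longleftrightarrow>
     x \<in> sparse_set s \<and>
     (l0 x < s \<longrightarrow> (\<forall>i t. f x \<le> f (x + t *\<^sub>R coord_vec i))) \<and>
     (l0 x = s \<longrightarrow> (\<forall>i\<in>I1 x. \<forall>j t. f x \<le> f (x - (x $ i) *\<^sub>R coord_vec i + t *\<^sub>R coord_vec j)))"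

end

theory Submission
  imports Defs
begin

text \<open>If k < s, every partial derivative of \<open>f\<close> vanishes at \<open>x\<close>: for
  a BF-vector by definition, for a CW-minimum by Fermat's rule along each coordinate line
  (\<open>partial_eq_0_if_coordinate_min\<close>). But k < s < n leaves \<open>x\<close> a zero
  entry (\<open>I0_nonempty\<close>), where nondegeneracy demands a nonzero partial
  derivative.\<close>

lemma I0_nonempty:
  fixes x :: "real ^ 'n"
  assumes "l0 x < CARD('n)"
  shows "I0 x \<noteq> {}"
proof
  assume "I0 x = {}"
  then have "{i. x $ i \<noteq> 0} = UNIV"
    by (auto simp: I0_def)
  with assms show False
    by (simp add: l0_def)
qed

text \<open>Fermat's rule at t = 0; \<open>C1\<close> ensures that the \<open>deriv\<close> in
  \<open>partial\<close> is a genuine derivative.\<close>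

lemma partial_eq_0_if_coordinate_min:
  assumes "C1 f" and "\<And>t. f x \<le> f (x + t *\<^sub>R coord_vec i)"
  shows "partial i f x = 0"
\<comment> \<open>The bound holds for all t, so the radius 1 is arbitrary.\<close>
proof (rule DERIV_local_min[where d = 1])
  show "DERIV (\<lambda>t. f (x + t *\<^sub>R coord_vec i)) 0 :> partial i f x"
    using assms(1) unfolding C1_def partial_def by (simp add: field_differentiable_derivI)
qed (use assms(2) in auto)

theorem proposition8:
  fixes f :: "real ^ 'n \<Rightarrow> real" and s k :: nat and x :: "real ^ 'n"
  assumes "s < CARD('n)"
    and "C2 f"
    and "l0 x = k"
  shows "(BF_vector f s x \<and> nondegenerate_M_stationary f s x \<longrightarrow> k = s) \<and>
         (CW_minimum f s x \<and> nondegenerate_M_stationary f s x \<longrightarrow> k = s)"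
proof -
  have crit: "\<forall>i. partial i f x = 0" if "CW_minimum f s x" "l0 x < s"
    using that \<open>C2 f\<close> by (auto simp: CW_minimum_def C2_def intro: partial_eq_0_if_coordinate_min)
  \<comment> \<open>The second premise is what BF-vectors and CW-minima share, so one argument
    serves both.\<close>
  have "l0 x = s" if "nondegenerate_M_stationary f s x" "l0 x < s \<Longrightarrow> \<forall>i. partial i f x = 0"
  proof (rule ccontr)
    assume "l0 x \<noteq> s"
    with that(1) have "l0 x < s"
      by (simp add: nondegenerate_M_stationary_def M_stationary_def sparse_set_def)
    moreover from this obtain i where "i \<in> I0 x"
      using I0_nonempty[of x] \<open>s < CARD('n)\<close> by auto
    ultimately show False
      using that by (auto simp: nondegenerate_M_stationary_def)
  qed
  with crit \<open>l0 x = k\<close> show ?thesis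
    by (auto simp: BF_vector_def)
qed

end
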